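(* Let $R>0$, $p\in(1,2]$ and set $$C=\left(\frac1R\int_0^{+\infty}\frac{dt}{1+t^p}\right)^{\frac{p}{p-1}}.$$ Then there exists a radial solution $u\in C^2(B_R)$ of $$-\lambda_N(D^2u)+|Du|^p=-C\ \text{ in }B_R,\qquad \lim_{x\to\partial B_R}u(x)=+\infty.$$
   Context: $B_R\subset\mathbb{R}^N$ is the open ball of radius $R$ centered at $0$. For a real symmetric $N\times N$ matrix $X$, $\lambda_N(X)$ denotes its largest eigenvalue. The boundary condition means $u(x)\to+\infty$ as $x\in B_R$, $|x|\to R^-$. Radial means that $u(x)$ depends only on $|x|$. *)

theory Defs
  imports "HOL-Analysis.Analysis"
begin

definition gradient :: "(real ^ 'n \<Rightarrow> real) \<Rightarrow> real ^ 'n \<Rightarrow> real ^ 'n" where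
  "gradient u x = (THE D. GDERIV u x :> D)"

definition hessian :: "(real ^ 'n \<Rightarrow> real) \<Rightarrow> real ^ 'n \<Rightarrow> real ^ 'n ^ 'n" where
  "hessian u x = jacobian (gradient u) (at x)"

(* Meant for open S, where differentiability within S is ordinary differentiability.
   Continuity of u and of its gradient follows from differentiability. *)
definition C2_on :: "(real ^ 'n) set \<Rightarrow> (real ^ 'n \<Rightarrow> real) \<Rightarrow> bool" where
  "C2_on S u \<longleftrightarrow>
     u differentiable_on S \<and> gradient u differentiable_on S \<and> continuous_on S (hessian u)"

definition eigenvalues :: "real ^ 'n ^ 'n \<Rightarrow> real set" where
  "eigenvalues X = {c. \<exists>v. v \<noteq> 0 \<and> X *v v = c *\<^sub>R v}"

(* Used for symmetric X only, whose set of real eigenvalues is finite and nonempty. *)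
definition lambda_max :: "real ^ 'n ^ 'n \<Rightarrow> real" where
  "lambda_max X = Max (eigenvalues X)"

definition radial_on :: "(real ^ 'n) set \<Rightarrow> (real ^ 'n \<Rightarrow> real) \<Rightarrow> bool" where
  "radial_on S u \<longleftrightarrow> (\<exists>f. \<forall>x\<in>S. u x = f (norm x))"

(* The filter describes norm x tending to R from below, so only points of the ball
   of radius R around 0 are involved and the limit is uniform in the direction of x. *)
definition blows_up_at_sphere :: "real \<Rightarrow> (real ^ 'n \<Rightarrow> real) \<Rightarrow> bool" where
  "blows_up_at_sphere R u \<longleftrightarrow> filterlim u at_top (filtercomap norm (at_left R))"

end

theory Submission
  imports Defs
begin

text \<open>
  The solution is sought in the form \<open>u x = g (norm x)\<close>. Away from the origin the Hessian of such
  a function has the radial eigenvalue \<open>g'' r\<close> and, in all directions orthogonal to \<open>x\<close>, the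
  tangential eigenvalue \<open>g' r / r\<close>. If \<open>g' 0 = 0\<close> and \<open>g''\<close> is nondecreasing, the mean value
  theorem gives \<open>g' r / r \<le> g'' r\<close>, so the largest eigenvalue is the radial one and the equation
  reduces to the ordinary differential equation \<open>g'' = C + \<bar>g'\<bar> powr p\<close>. Conversely, every
  solution of that equation with \<open>g' 0 = 0\<close> has an increasing \<open>g'\<close>, hence a nondecreasing
  \<open>g''\<close> on the positive axis. Smoothness at the origin, where the norm is not differentiable,
  comes from \<open>g' r / r\<close> tending to \<open>g'' 0\<close>. These facts are \<open>C2_on_radial\<close> and
  \<open>lambda_max_hessian_radial\<close>.

  The equation for \<open>g'\<close> is autonomous and separable. The time that a solution of
  \<open>\<psi>' = 1 + \<bar>\<psi>\<bar> powr p\<close> takes from \<open>0\<close> to \<open>y\<close> is the integral of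
  \<open>1 / (1 + \<bar>t\<bar> powr p)\<close> from \<open>0\<close> to \<open>y\<close>. For \<open>p > 1\<close> this has a finite limit \<open>I\<close>, and \<open>\<psi>\<close>,
  the inverse of the travel time, lives exactly on the interval from \<open>- I\<close> to \<open>I\<close>. The rescaling
  \<open>g' r = a * \<psi> (b * r)\<close> with \<open>b = I / R\<close> makes the blow-up happen at \<open>R\<close>; it solves
  the equation with constant \<open>C\<close> precisely when \<open>a * b = C = a powr p\<close>, which forces
  \<open>C = b powr (p / (p - 1))\<close>. Finally \<open>g\<close> itself, expressed through the value \<open>y\<close> of \<open>\<psi>\<close>, is a
  multiple of the integral of \<open>t / (1 + \<bar>t\<bar> powr p)\<close> from \<open>0\<close> to \<open>y\<close>. Here \<open>p \<le> 2\<close> enters: the integrand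
  dominates a multiple of \<open>1 / t\<close>, so the integral diverges (\<open>energy_at_top\<close>) and \<open>g\<close>, not only
  \<open>g'\<close>, blows up at \<open>R\<close> (\<open>blow_up_profile\<close>).
\<close>

section \<open>The largest eigenvalue of a rank-one update\<close>

text \<open>
  Taking the inner product of an eigenvalue equation with \<open>e\<close> leaves only two candidates: \<open>a\<close> for
  eigenvectors orthogonal to \<open>e\<close>, and \<open>a + m\<close> for all others. In dimension one there are no
  eigenvectors of the first kind, so only the inclusion in \<open>{a, a + m}\<close> holds in general.
\<close>

lemma lambda_max_rank_one_update:
  fixes X :: "real ^ 'n ^ 'n"
  assumes X: "\<And>h. X *v h = a *\<^sub>R h + (m * (h \<bullet> e)) *\<^sub>R e"
    and e: "norm e = 1" and m: "m \<ge> 0"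
  shows "lambda_max X = a + m"
proof -
  have ee: "e \<bullet> e = 1"
    using e by (simp add: norm_eq_1)
  have "a + m \<in> eigenvalues X"
    using e unfolding eigenvalues_def by (auto simp: X ee algebra_simps intro!: exI[of _ e])
  moreover have sub: "eigenvalues X \<subseteq> {a, a + m}"
  proof
    fix c assume "c \<in> eigenvalues X"
    then obtain v where v: "v \<noteq> 0" "a *\<^sub>R v + (m * (v \<bullet> e)) *\<^sub>R e = c *\<^sub>R v"
      by (auto simp: eigenvalues_def X)
    show "c \<in> {a, a + m}"
    proof (cases "v \<bullet> e = 0")
      case True
      with v show ?thesis by auto
    next
      case False
      have "(a *\<^sub>R v + (m * (v \<bullet> e)) *\<^sub>R e) \<bullet> e = (c *\<^sub>R v) \<bullet> e"
        using v(2) by simp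
      then have "(a + m) * (v \<bullet> e) = c * (v \<bullet> e)"
        by (simp add: inner_add_left ee algebra_simps)
      with False show ?thesis by auto
    qed
  qed
  ultimately show ?thesis
    unfolding lambda_max_def using m
    by (intro Max_eqI) (auto intro: finite_subset[OF sub])
qed

section \<open>Calculus of radial functions\<close>

text \<open>
  The profile lives on an interval symmetric about \<open>0\<close>, so that its derivatives at \<open>0\<close>, the radius
  of the origin, are ordinary two-sided ones.
\<close>

locale radial_profile =
  fixes R :: real and g g' g'' :: "real \<Rightarrow> real"
  assumes R_pos: "R > 0"
    and deriv: "\<And>r. \<bar>r\<bar> < R \<Longrightarrow> (g has_real_derivative g' r) (at r)"
    and deriv': "\<And>r. \<bar>r\<bar> < R \<Longrightarrow> (g' has_real_derivative g'' r) (at r)"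
    and cont'': "\<And>r. \<bar>r\<bar> < R \<Longrightarrow> isCont g'' r"
    and deriv_0: "g' 0 = 0"
begin

text \<open>
  The eigenvalue of the Hessian on the orthogonal complement of \<open>x\<close>, extended continuously to
  \<open>r = 0\<close>. The gradient is this factor times \<open>x\<close>, a formula that also covers the origin.
\<close>

definition tangential :: "real \<Rightarrow> real" where
  "tangential r = (if r = 0 then g'' 0 else g' r / r)"

lemma tangential_mult: "tangential r * r = g' r"
  by (simp add: tangential_def deriv_0)

lemma isCont_tangential:
  assumes "\<bar>r\<bar> < R"
  shows "isCont tangential r"
proof (cases "r = 0")
  case True
  have "(\<lambda>h. g' h / h) \<midarrow>0\<rightarrow> g'' 0"
    using deriv'[of 0] R_pos by (simp add: DERIV_def deriv_0)
  then have "tangential \<midarrow>0\<rightarrow> g'' 0"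
    by (rule Lim_transform_eventually)
       (simp add: eventually_at_filter tangential_def)
  then show ?thesis
    by (simp add: True isCont_def tangential_def)
next
  case False
  have "isCont (\<lambda>s. g' s / s) r"
    using False DERIV_isCont[OF deriv'[OF assms]] by (intro continuous_intros) auto
  moreover have "eventually (\<lambda>s. g' s / s = tangential s) (nhds r)"
    using t1_space_nhds[OF False] by (rule eventually_mono) (simp add: tangential_def)
  ultimately show ?thesis
    by (simp cong: isCont_cong)
qed

lemma deriv_tangential:
  assumes "\<bar>r\<bar> < R" "r \<noteq> 0"
  shows "(tangential has_real_derivative (g'' r - tangential r) / r) (at r)"
proof -
  have "((\<lambda>s. g' s / s) has_real_derivative (g'' r - tangential r) / r) (at r)"
    using assms deriv'[OF assms(1)]
    by (auto intro!: derivative_eq_intros simp: tangential_def field_simps)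
  then show ?thesis
    by (rule has_field_derivative_transform_within_open[where S = "- {0}"])
       (use assms in \<open>auto simp: tangential_def\<close>)
qed

text \<open>
  At the origin the chain rule fails because of the norm; there the difference quotient of the
  radial function is that of \<open>g\<close> taken at \<open>norm h\<close>, up to sign, and tends to \<open>g' 0 = 0\<close>.
\<close>

lemma GDERIV_radial:
  fixes x :: "'a::real_inner"
  assumes x: "norm x < R"
  shows "GDERIV (\<lambda>x. g (norm x)) x :> tangential (norm x) *\<^sub>R x"
proof (cases "x = 0")
  case True
  have "(\<lambda>h. (g h - g 0) / h) \<midarrow>0\<rightarrow> 0"
    using deriv[of 0] R_pos by (simp add: DERIV_def deriv_0)
  moreover have "filterlim norm (at 0) (at (0::'a))"
    by (auto simp: filterlim_at eventually_at_filter intro!: tendsto_eq_intros)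
  ultimately have "(\<lambda>h::'a. (g (norm h) - g 0) / norm h) \<midarrow>0\<rightarrow> 0"
    by (rule filterlim_compose)
  then have "(\<lambda>h::'a. \<bar>g (norm h) - g 0\<bar> / norm h) \<midarrow>0\<rightarrow> 0"
    by (drule_tac tendsto_rabs_zero) simp
  then show ?thesis
    by (simp add: True gderiv_def has_derivative_at)
next
  case False
  have "GDERIV (\<lambda>x. g (norm x)) x :> g' (norm x) *\<^sub>R sgn x"
    using GDERIV_norm[OF False] deriv[of "norm x"] x by (intro GDERIV_DERIV_compose) auto
  then show ?thesis
    using False by (simp add: tangential_def sgn_div_norm divide_inverse)
qed

text \<open>
  The product rule applied to \<open>tangential (norm x) *\<^sub>R x\<close> yields a multiple of the identity plus
  a rank-one term in the direction \<open>sgn x\<close>. As \<open>sgn 0 = 0\<close>, the formula covers the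
  origin, where it says that the derivative is \<open>g'' 0\<close> times the identity.
\<close>

lemma has_derivative_radial_gradient:
  fixes x :: "'a::real_inner"
  assumes x: "norm x < R"
  shows "((\<lambda>x. tangential (norm x) *\<^sub>R x) has_derivative
     (\<lambda>h. tangential (norm x) *\<^sub>R h
        + ((g'' (norm x) - tangential (norm x)) * (h \<bullet> sgn x)) *\<^sub>R sgn x)) (at x)"
proof (cases "x = 0")
  case True
  have "isCont tangential 0"
    using R_pos by (intro isCont_tangential) simp
  then have "(\<lambda>h::'a. tangential (norm h)) \<midarrow>0\<rightarrow> tangential (norm (0::'a))"
    by (intro isCont_tendsto_compose[of _ tangential] tendsto_intros) simp
  then have "(\<lambda>h::'a. \<bar>tangential (norm h) - tangential 0\<bar>) \<midarrow>0\<rightarrow> 0"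
    by (auto intro!: tendsto_rabs_zero simp: LIM_zero)
  then have "(\<lambda>h::'a. norm (tangential (norm h) *\<^sub>R h - tangential 0 *\<^sub>R h) / norm h) \<midarrow>0\<rightarrow> 0"
    by (rule Lim_transform_eventually)
       (simp add: eventually_at_filter flip: scaleR_diff_left)
  then show ?thesis
    by (simp add: True has_derivative_at bounded_linear_scaleR_right)
next
  case False
  have "GDERIV (\<lambda>x. tangential (norm x)) x
      :> ((g'' (norm x) - tangential (norm x)) / norm x) *\<^sub>R sgn x"
    using GDERIV_norm[OF False] deriv_tangential[of "norm x"] x False
    by (intro GDERIV_DERIV_compose) auto
  from has_derivative_scaleR[OF this[unfolded gderiv_def] has_derivative_ident]
  show ?thesis
    by (rule has_derivative_eq_rhs)
       (auto simp: fun_eq_iff sgn_div_norm divide_inverse)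
qed

lemma gradient_radial:
  fixes x :: "real ^ 'n"
  assumes "norm x < R"
  shows "gradient (\<lambda>x. g (norm x)) x = tangential (norm x) *\<^sub>R x"
  unfolding gradient_def
proof (rule the_equality)
  show G: "GDERIV (\<lambda>x. g (norm x)) x :> tangential (norm x) *\<^sub>R x"
    using assms by (rule GDERIV_radial)
  fix D assume "GDERIV (\<lambda>x. g (norm x)) x :> D"
  with G have "(\<lambda>h. h \<bullet> D) = (\<lambda>h. h \<bullet> (tangential (norm x) *\<^sub>R x))"
    unfolding gderiv_def by (rule has_derivative_unique[symmetric])
  then show "D = tangential (norm x) *\<^sub>R x"
    by (auto simp: fun_eq_iff vector_eq_ldot simp del: inner_scaleR_right)
qed

lemma has_derivative_gradient_radial:
  fixes x :: "real ^ 'n"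
  assumes x: "norm x < R"
  shows "(gradient (\<lambda>x. g (norm x)) has_derivative
     (\<lambda>h. tangential (norm x) *\<^sub>R h
        + ((g'' (norm x) - tangential (norm x)) * (h \<bullet> sgn x)) *\<^sub>R sgn x)) (at x)"
  using has_derivative_radial_gradient[OF x]
  by (rule has_derivative_transform_within_open[where s = "ball 0 R"])
     (use x in \<open>auto simp: gradient_radial\<close>)

lemma hessian_radial_mult:
  fixes x h :: "real ^ 'n"
  assumes x: "norm x < R"
  shows "hessian (\<lambda>x. g (norm x)) x *v h = tangential (norm x) *\<^sub>R h
        + ((g'' (norm x) - tangential (norm x)) * (h \<bullet> sgn x)) *\<^sub>R sgn x"
proof -
  note D = has_derivative_gradient_radial[OF x]
  have "gradient (\<lambda>x. g (norm x)) differentiable (at x)"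
    using D by (rule differentiableI)
  then have "(gradient (\<lambda>x. g (norm x)) has_derivative
      (*v) (hessian (\<lambda>x. g (norm x)) x)) (at x)"
    unfolding hessian_def by (simp add: jacobian_works)
  from has_derivative_unique[OF this D] show ?thesis
    by (rule fun_cong)
qed

lemma hessian_radial_component:
  fixes x :: "real ^ 'n"
  assumes "norm x < R"
  shows "hessian (\<lambda>x. g (norm x)) x $ i $ j
    = tangential (norm x) * (if i = j then 1 else 0)
      + (g'' (norm x) - tangential (norm x)) * (sgn x $ i * sgn x $ j)"
proof -
  have "hessian (\<lambda>x. g (norm x)) x $ i $ j = (hessian (\<lambda>x. g (norm x)) x *v axis j 1) $ i"
    by (simp add: matrix_vector_mult_basis column_def)
  also have "\<dots> = tangential (norm x) * (axis j 1 :: real ^ 'n) $ i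
      + (g'' (norm x) - tangential (norm x)) * (sgn x $ i * sgn x $ j)"
    unfolding hessian_radial_mult[OF assms] by (simp add: inner_axis')
  also have "(axis j 1 :: real ^ 'n) $ i = (if i = j then 1 else 0)"
    by (simp add: axis_def)
  finally show ?thesis .
qed

text \<open>
  The direction \<open>sgn x\<close> is discontinuous at the origin, but its components are bounded and the
  factor \<open>g'' - tangential\<close> vanishes there.
\<close>

lemma isCont_anisotropy:
  fixes x :: "real ^ 'n"
  assumes x: "norm x < R"
  shows "isCont (\<lambda>x. (g'' (norm x) - tangential (norm x)) * (sgn x $ i * sgn x $ j)) x"
proof -
  have m: "isCont (\<lambda>x::real^'n. g'' (norm x) - tangential (norm x)) x"
    using x by (intro continuous_intros isCont_o2[OF continuous_norm[OF continuous_ident]]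
        cont'' isCont_tangential) auto
  show ?thesis
  proof (cases "x = 0")
    case True
    have *: "norm (sgn y $ i * sgn y $ j) \<le> 1" for y :: "real ^ 'n"
    proof -
      have "\<bar>sgn y $ l\<bar> \<le> 1" for l
        using component_le_norm_cart[of "sgn y" l] norm_sgn[of y] by (auto split: if_splits)
      then show ?thesis
        by (simp add: abs_mult mult_le_one)
    qed
    have "(\<lambda>y::real^'n. g'' (norm y) - tangential (norm y)) \<midarrow>0\<rightarrow> 0"
      using m by (simp add: True isCont_def tangential_def)
    then have "(\<lambda>y. (g'' (norm y) - tangential (norm y)) * (sgn y $ i * sgn y $ j)) \<midarrow>(0::real^'n)\<rightarrow> 0"
      by (rule Lim_null_comparison[OF _ tendsto_norm_zero, rotated])
         (use * in \<open>auto simp: abs_mult intro!: always_eventually mult_left_le\<close>)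
    then show ?thesis
      by (simp add: True isCont_def)
  next
    case False
    have "isCont (\<lambda>x::real^'n. sgn x $ l) x" for l
      unfolding sgn_div_norm using False by (intro continuous_intros) auto
    then show ?thesis
      by (intro continuous_mult m)
  qed
qed

theorem C2_on_radial: "C2_on (ball 0 R) (\<lambda>x :: real ^ 'n. g (norm x))"
  unfolding C2_on_def
proof (intro conjI)
  show "(\<lambda>x :: real ^ 'n. g (norm x)) differentiable_on ball 0 R"
    unfolding differentiable_on_eq_differentiable_at[OF open_ball]
    by (intro ballI differentiableI[OF GDERIV_radial[unfolded gderiv_def]]) simp
  show "gradient (\<lambda>x :: real ^ 'n. g (norm x)) differentiable_on ball 0 R"
    unfolding differentiable_on_eq_differentiable_at[OF open_ball]
    by (intro ballI differentiableI[OF has_derivative_gradient_radial]) simp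
  have t: "isCont (\<lambda>x :: real ^ 'n. tangential (norm x)) x" if "norm x < R" for x
    using that
    by (intro isCont_o2[OF continuous_norm[OF continuous_ident], where g = tangential]
        isCont_tangential) simp
  have "continuous_on (ball 0 R) (\<lambda>x :: real ^ 'n. \<chi> i j.
      tangential (norm x) * (if i = j then 1 else 0)
      + (g'' (norm x) - tangential (norm x)) * (sgn x $ i * sgn x $ j))"
    by (intro continuous_on_vec_lambda continuous_at_imp_continuous_on ballI isCont_add
        isCont_mult[OF t continuous_const] isCont_anisotropy) auto
  then show "continuous_on (ball 0 R) (hessian (\<lambda>x :: real ^ 'n. g (norm x)))"
    by (rule continuous_on_eq) (simp add: vec_eq_iff hessian_radial_component)
qed

lemma norm_gradient_radial:
  fixes x :: "real ^ 'n"
  assumes "norm x < R"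
  shows "norm (gradient (\<lambda>x. g (norm x)) x) = \<bar>g' (norm x)\<bar>"
  unfolding gradient_radial[OF assms] by (simp add: abs_mult flip: tangential_mult)

text \<open>By the mean value theorem, \<open>g' r / r\<close> is a value of \<open>g''\<close> at a smaller radius.\<close>

lemma tangential_le_second_deriv:
  assumes mono: "\<And>s r. 0 \<le> s \<Longrightarrow> s \<le> r \<Longrightarrow> r < R \<Longrightarrow> g'' s \<le> g'' r"
    and r: "0 \<le> r" "r < R"
  shows "tangential r \<le> g'' r"
proof (cases "r = 0")
  case False
  with r have "0 < r" by simp
  then obtain s where s: "0 < s" "s < r" "g' r - g' 0 = (r - 0) * g'' s"
    using MVT2[of 0 r g' g''] deriv' r by auto
  then have "tangential r = g'' s"
    using False by (simp add: tangential_def deriv_0)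
  then show ?thesis
    using mono[of s r] s r by simp
qed (simp add: tangential_def)

theorem lambda_max_hessian_radial:
  fixes x :: "real ^ 'n"
  assumes mono: "\<And>s r. 0 \<le> s \<Longrightarrow> s \<le> r \<Longrightarrow> r < R \<Longrightarrow> g'' s \<le> g'' r"
    and x: "norm x < R"
  shows "lambda_max (hessian (\<lambda>x. g (norm x)) x) = g'' (norm x)"
proof -
  (* At the origin the rank-one term has coefficient 0, and any unit vector serves as direction. *)
  define e where "e = (if x = 0 then axis undefined 1 else sgn x)"
  define m where "m = g'' (norm x) - tangential (norm x)"
  have "lambda_max (hessian (\<lambda>x. g (norm x)) x) = tangential (norm x) + m"
  proof (rule lambda_max_rank_one_update)
    show "norm e = 1"
      by (simp add: e_def norm_sgn)
    show "0 \<le> m"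
      using tangential_le_second_deriv[OF mono, of "norm x"] x by (simp add: m_def)
    show "hessian (\<lambda>x. g (norm x)) x *v h = tangential (norm x) *\<^sub>R h + (m * (h \<bullet> e)) *\<^sub>R e" for h
      using x by (simp add: hessian_radial_mult e_def m_def tangential_def)
  qed
  then show ?thesis
    by (simp add: m_def)
qed

end

section \<open>The profile that blows up\<close>

lemma one_plus_powr_pos: "1 + \<bar>t\<bar> powr p > (0::real)"
  by (metis add_pos_nonneg less_numeral_extra(1) powr_ge_zero)

lemma real_antiderivative:
  fixes f :: "real \<Rightarrow> real"
  assumes "continuous_on UNIV f"
  obtains F where "\<And>x. (F has_real_derivative f x) (at x)" "F 0 = 0"
proof -
  have "\<exists>F. \<forall>x::real. -\<infinity> < ereal x \<longrightarrow> ereal x < \<infinity> \<longrightarrow> (F has_vector_derivative f x) (at x)"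
    using assms by (intro einterval_antiderivative) (auto simp: continuous_on_eq_continuous_at)
  then obtain F where F: "\<And>x. (F has_real_derivative f x) (at x)"
    by (auto simp: has_real_derivative_iff_has_vector_derivative)
  have "((\<lambda>x. F x - F 0) has_real_derivative f x) (at x)" for x
    by (auto intro!: derivative_eq_intros F)
  then show thesis
    by (rule that) simp
qed

lemma isCont_abs_powr:
  fixes p t :: real
  assumes "0 < p"
  shows "isCont (\<lambda>t. \<bar>t\<bar> powr p) t"
  unfolding isCont_def
  by (rule tendsto_powr'[OF tendsto_rabs[OF tendsto_ident_at] tendsto_const]) (use assms in simp)

lemma continuous_on_reciprocal_one_plus_powr:
  fixes p :: real
  assumes "0 < p"
  shows "continuous_on UNIV (\<lambda>t::real. 1 / (1 + \<bar>t\<bar> powr p))"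
proof (intro continuous_at_imp_continuous_on ballI)
  fix t :: real
  show "isCont (\<lambda>t. 1 / (1 + \<bar>t\<bar> powr p)) t"
    using one_plus_powr_pos[of t p]
    by (intro isCont_divide isCont_add continuous_const isCont_abs_powr assms) simp
qed

text \<open>
  The travel time \<open>F\<close> stays bounded because its derivative is at most \<open>t powr (- p)\<close> with \<open>p > 1\<close>;
  monotonicity then gives a limit, which is the improper integral by monotone convergence. Without
  convergence the integral would have the default value \<open>0\<close>.
\<close>

lemma travel_time_tendsto:
  fixes p :: real and F :: "real \<Rightarrow> real"
  assumes p: "1 < p" and F0: "F 0 = 0"
    and F: "\<And>t. (F has_real_derivative 1 / (1 + \<bar>t\<bar> powr p)) (at t)"
  shows "(F \<longlongrightarrow> integral {0..} (\<lambda>t::real. 1 / (1 + t powr p))) at_top"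
proof -
  note pos = one_plus_powr_pos[of _ p]
  have mono: "mono F"
  proof (rule monoI, erule DERIV_nonneg_imp_nondecreasing)
    show "\<exists>y. (F has_real_derivative y) (at t) \<and> 0 \<le> y" for t
      using F[of t] pos[of t] by (intro exI[of _ "1 / (1 + \<bar>t\<bar> powr p)"]) simp
  qed
  have bound: "F t \<le> F 1 + 1 / (p - 1)" if t: "1 \<le> t" for t
  proof -
    (* F t plus the tail t powr (1 - p) / (p - 1) of the integral of t powr (- p) is nonincreasing. *)
    have "- (F 1 + 1 powr (1 - p) / (p - 1)) \<le> - (F t + t powr (1 - p) / (p - 1))"
    proof (rule DERIV_nonneg_imp_nondecreasing[OF t])
      fix s :: real assume s: "1 \<le> s" "s \<le> t"
      have "((\<lambda>t. - (F t + t powr (1 - p) / (p - 1))) has_real_derivative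
          s powr (-p) - 1 / (1 + s powr p)) (at s)"
      proof -
        have "((\<lambda>t. t powr (1 - p) / (p - 1)) has_real_derivative
            (1 - p) * s powr (1 - p - 1) / (p - 1)) (at s)"
          using s by (intro DERIV_cdivide has_real_derivative_powr) simp
        moreover have "(1 - p) * s powr (1 - p - 1) / (p - 1) = - (s powr (- p))"
          using p by (simp add: divide_eq_eq) (simp add: algebra_simps)
        ultimately show ?thesis
          using DERIV_minus[OF DERIV_add[OF F[of s]]] s by fastforce
      qed
      moreover have "1 / (1 + s powr p) \<le> s powr (-p)"
        using s by (simp add: powr_minus divide_inverse le_imp_inverse_le)
      ultimately show "\<exists>y. ((\<lambda>t. - (F t + t powr (1 - p) / (p - 1))) has_real_derivative y) (at s) \<and> 0 \<le> y"
        by force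
    qed
    moreover have "t powr (1 - p) / (p - 1) \<ge> 0"
      using p by simp
    ultimately show ?thesis by simp
  qed
  have "F (real n) \<le> F 1 + 1 / (p - 1)" for n
    using order_trans[OF monoD[OF mono, of "real n" "real n + 1"] bound[of "real n + 1"]] by simp
  moreover have "incseq (\<lambda>n. F (real n))"
    by (intro incseq_SucI monoD[OF mono]) simp
  ultimately obtain L where "(\<lambda>n. F (real n)) \<longlonglongrightarrow> L"
    using incseq_convergent by blast
  then have L: "(F \<longlongrightarrow> L) at_top"
    by (rule tendsto_at_topI_sequentially_real[OF mono])
  have int: "((\<lambda>t. 1 / (1 + t powr p)) has_integral F y) {0..y}" if "0 \<le> y" for y
  proof -
    have "((\<lambda>t. 1 / (1 + \<bar>t\<bar> powr p)) has_integral F y - F 0) {0..y}"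
      using F[unfolded has_real_derivative_iff_has_vector_derivative]
      by (intro fundamental_theorem_of_calculus that) (rule has_vector_derivative_at_within)
    then show ?thesis
      unfolding F0 diff_0_right by (rule has_integral_eq[rotated]) simp
  qed
  have "((\<lambda>t. 1 / (1 + t powr p)) has_integral L) {0..}"
  proof (rule has_integral_to_inf)
    show "(\<lambda>t. 1 / (1 + t powr p)) integrable_on {0..y}" for y
      using int[of y] by (cases "0 \<le> y") (auto simp: integrable_on_def)
    have "eventually (\<lambda>y. F y = integral {0..y} (\<lambda>t. 1 / (1 + t powr p))) at_top"
      using int by (auto intro!: eventually_at_top_linorderI[of 0] integral_unique[symmetric])
    with L show "((\<lambda>y. integral {0..y} (\<lambda>t. 1 / (1 + t powr p))) \<longlongrightarrow> L) at_top"
      by (rule Lim_transform_eventually)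
  qed (auto intro!: divide_nonneg_nonneg)
  with L show ?thesis
    by (simp add: integral_unique)
qed

text \<open>
  Oddness turns the limit \<open>L\<close> at \<open>+\<infinity>\<close> into the limit \<open>- L\<close> at \<open>-\<infinity>\<close>, so by the intermediate
  value theorem \<open>F\<close> maps onto the whole open interval from \<open>- L\<close> to \<open>L\<close>.
\<close>

lemma inverse_of_increasing_odd:
  fixes F f :: "real \<Rightarrow> real"
  assumes F: "\<And>t. (F has_real_derivative f t) (at t)" and pos: "\<And>t. f t > 0"
    and odd: "\<And>t. F (- t) = - F t" and lim: "(F \<longlongrightarrow> L) at_top"
  obtains G where "\<And>t. G (F t) = t" "\<And>s. \<bar>s\<bar> < L \<Longrightarrow> F (G s) = s"
    "\<And>s. \<bar>s\<bar> < L \<Longrightarrow> (G has_real_derivative inverse (f (G s))) (at s)"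
    "\<And>t. F t < L"
proof
  let ?G = "inv F"
  have strict: "F s < F t" if "s < t" for s t
    using that F pos by (intro DERIV_pos_imp_increasing[OF that]) blast
  then have inj: "inj F"
    by (intro linorder_injI) force
  then show GF: "?G (F t) = t" for t
    by simp
  have cont: "isCont F t" for t
    using F DERIV_isCont by blast
  show "F t < L" for t
  proof -
    have "F t < F (t + 1)" by (rule strict) simp
    also have "F (t + 1) \<le> L"
      by (rule tendsto_lowerbound[OF lim])
         (auto intro!: eventually_at_top_linorderI[of "t + 1"] dest: strict simp: le_less)
    finally show ?thesis .
  qed
  show FG: "F (?G s) = s" if s: "\<bar>s\<bar> < L" for s
  proof -
    have "eventually (\<lambda>t. \<bar>s\<bar> < F t \<and> t \<ge> 0) at_top"
      using order_tendstoD(1)[OF lim s] eventually_ge_at_top[of 0] by eventually_elim simp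
    then obtain t where t: "\<bar>s\<bar> < F t" "t \<ge> 0"
      by (auto dest: eventually_happens)
    then obtain y where "F y = s"
      using IVT[of F "- t" s t] odd[of t] cont by (auto simp: abs_less_iff)
    then show ?thesis
      by (metis GF)
  qed
  show "(?G has_real_derivative inverse (f (?G s))) (at s)" if s: "\<bar>s\<bar> < L" for s
  proof -
    have "(?G has_derivative (*) (inverse (f (?G s)))) (at (F (?G s)))"
    proof (rule has_derivative_inverse_strong[where S = UNIV and f = F])
      show "(F has_derivative (*) (f (?G s))) (at (?G s))"
        using F[of "?G s"] by (simp add: has_field_derivative_def)
      show "(*) (f (?G s)) \<circ> (*) (inverse (f (?G s))) = id"
        using pos[of "?G s"] by (auto simp: fun_eq_iff)
    qed (use GF cont in \<open>auto simp: continuous_on_eq_continuous_at\<close>)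
    then show ?thesis
      by (simp add: FG[OF s] has_field_derivative_def)
  qed
qed

text \<open>
  The bound \<open>1 + t powr p \<le> 2 * t\<^sup>2\<close>, valid for \<open>t \<ge> 1\<close> because of \<open>p \<le> 2\<close>, shows that \<open>H\<close> grows
  at least like \<open>ln t / 2\<close>.
\<close>

lemma energy_at_top:
  fixes p :: real and H :: "real \<Rightarrow> real"
  assumes p: "1 < p" "p \<le> 2"
    and H: "\<And>t. (H has_real_derivative t / (1 + \<bar>t\<bar> powr p)) (at t)"
  shows "filterlim H at_top at_top"
proof -
  have bound: "H 1 + ln t / 2 \<le> H t" if t: "1 \<le> t" for t
  proof -
    have "H 1 - ln 1 / 2 \<le> H t - ln t / 2"
    proof (rule DERIV_nonneg_imp_nondecreasing[OF t])
      fix s :: real assume s: "1 \<le> s" "s \<le> t"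
      have "s powr p \<le> s powr 2"
        using s p by (intro powr_mono) auto
      then have "1 + s powr p \<le> 2 * (s * s)"
        using s mult_mono[of 1 s 1 s] by (simp add: powr_numeral power2_eq_square)
      then have "1 / s / 2 \<le> s / (1 + s powr p)"
        using s by (simp add: field_simps add_pos_nonneg)
      moreover have "((\<lambda>t. H t - ln t / 2) has_real_derivative s / (1 + s powr p) - 1 / s / 2) (at s)"
        using s H[of s] by (auto intro!: derivative_eq_intros)
      ultimately show "\<exists>y. ((\<lambda>t. H t - ln t / 2) has_real_derivative y) (at s) \<and> 0 \<le> y"
        by force
    qed
    then show ?thesis by simp
  qed
  have "filterlim (\<lambda>t::real. H 1 + ln t / 2) at_top at_top"
    by (intro filterlim_tendsto_add_at_top[OF tendsto_const]
        filterlim_at_top_mult_tendsto_pos[OF tendsto_const, of "1/2", simplified] ln_at_top)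
  then show ?thesis
    by (rule filterlim_at_top_mono)
       (auto intro!: eventually_at_top_linorderI[of 1] bound)
qed

text \<open>
  With \<open>\<psi>\<close> the inverse of the travel time \<open>F\<close> and \<open>H' t = t / (1 + \<bar>t\<bar> powr p)\<close>, the derivative of
  \<open>H \<circ> \<psi>\<close> is \<open>\<psi>\<close>, since the factor \<open>\<psi>' = 1 + \<bar>\<psi>\<bar> powr p\<close> cancels the denominator. Rescaling
  \<open>H \<circ> \<psi>\<close> gives \<open>g\<close>.
\<close>

lemma blow_up_profile:
  fixes R p C :: real
  assumes R: "R > 0" and p: "1 < p" "p \<le> 2"
    and C: "C = (1 / R * integral {0..} (\<lambda>t::real. 1 / (1 + t powr p))) powr (p / (p - 1))"
  obtains g g' where "\<And>r. \<bar>r\<bar> < R \<Longrightarrow> (g has_real_derivative g' r) (at r)"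
    "\<And>r. \<bar>r\<bar> < R \<Longrightarrow> (g' has_real_derivative C + \<bar>g' r\<bar> powr p) (at r)"
    "g' 0 = 0" "filterlim g at_top (at_left R)"
proof -
  define I where "I = integral {0..} (\<lambda>t::real. 1 / (1 + t powr p))"
  note pos = one_plus_powr_pos[of _ p]
  note cont = continuous_on_reciprocal_one_plus_powr[OF less_trans[OF zero_less_one p(1)]]
  obtain F where F: "\<And>t. (F has_real_derivative 1 / (1 + \<bar>t\<bar> powr p)) (at t)" and F0: "F 0 = 0"
    using real_antiderivative[OF cont] by metis
  have cont': "continuous_on UNIV (\<lambda>t::real. t * (1 / (1 + \<bar>t\<bar> powr p)))"
    by (rule continuous_on_mult[OF continuous_on_id cont])
  obtain H where "\<And>t. (H has_real_derivative t * (1 / (1 + \<bar>t\<bar> powr p))) (at t)"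
    using real_antiderivative[OF cont'] by metis
  then have H: "(H has_real_derivative t / (1 + \<bar>t\<bar> powr p)) (at t)" for t
    by simp
  have lim: "(F \<longlongrightarrow> I) at_top"
    unfolding I_def by (rule travel_time_tendsto[OF p(1) F0 F])
  have odd: "F (- t) = - F t" for t
  proof -
    have "((\<lambda>t. F t + F (- t)) has_real_derivative 0) (at t)" for t
      using DERIV_add[OF F[of t] F[of "- t", unfolded DERIV_mirror]] by simp
    then have "F t + F (- t) = F 0 + F (- 0)"
      by (intro DERIV_isconst_all[of "\<lambda>t. F t + F (- t)"]) simp
    then show ?thesis
      by (simp add: F0)
  qed
  obtain \<psi> where \<psi>F: "\<And>t. \<psi> (F t) = t" and F\<psi>: "\<And>s. \<bar>s\<bar> < I \<Longrightarrow> F (\<psi> s) = s"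
    and "\<And>s. \<bar>s\<bar> < I \<Longrightarrow> (\<psi> has_real_derivative inverse (1 / (1 + \<bar>\<psi> s\<bar> powr p))) (at s)"
    and F_less: "\<And>t. F t < I"
    using inverse_of_increasing_odd[OF F _ odd lim] pos by (metis zero_less_divide_1_iff)
  then have D\<psi>: "(\<psi> has_real_derivative 1 + \<bar>\<psi> s\<bar> powr p) (at s)" if "\<bar>s\<bar> < I" for s
    using that by force
  have I: "I > 0"
    using F_less[of 0] F0 by simp
  (* b stretches the life span I of the solution to R; a is then fixed by a * b = a powr p. *)
  define b where "b = I / R"
  define a where "a = b powr (1 / (p - 1))"
  have b: "b > 0" and a: "a > 0"
    using I R by (auto simp: a_def b_def)
  have Cb: "C = b powr (p / (p - 1))"
    by (simp add: C b_def I_def)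
  have ap: "a powr p = C"
    using p by (simp add: a_def Cb powr_powr)
  have "1 / (p - 1) + 1 = p / (p - 1)"
    using p by (simp add: field_simps)
  then have ab: "a * b = C"
    using b powr_add[of b "1 / (p - 1)" 1] by (simp add: a_def Cb)
  have in_I: "\<bar>b * r\<bar> < I" if "\<bar>r\<bar> < R" for r
    using that R I by (simp add: b_def abs_mult field_simps)
  have D\<psi>b: "((\<lambda>r. \<psi> (b * r)) has_real_derivative (1 + \<bar>\<psi> (b * r)\<bar> powr p) * b) (at r)"
    if "\<bar>r\<bar> < R" for r
  proof (rule DERIV_chain2[where f = \<psi> and g = "\<lambda>r. b * r"])
    show "(\<psi> has_real_derivative 1 + \<bar>\<psi> (b * r)\<bar> powr p) (at (b * r))"
      using that by (intro D\<psi> in_I)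
    show "((\<lambda>r. b * r) has_real_derivative b) (at r)"
      using DERIV_cmult_Id .
  qed
  show thesis
  proof (rule that[of "\<lambda>r. a / b * H (\<psi> (b * r))" "\<lambda>r. a * \<psi> (b * r)"])
    show "((\<lambda>r. a / b * H (\<psi> (b * r))) has_real_derivative a * \<psi> (b * r)) (at r)" if "\<bar>r\<bar> < R" for r
    proof -
      from DERIV_cmult[OF DERIV_chain2[OF H D\<psi>b[OF that]], of "a / b"]
      have "((\<lambda>r. a / b * H (\<psi> (b * r))) has_real_derivative a / b *
          (\<psi> (b * r) / (1 + \<bar>\<psi> (b * r)\<bar> powr p) * ((1 + \<bar>\<psi> (b * r)\<bar> powr p) * b))) (at r)" .
      moreover have "a / b * (y / q * (q * b)) = a * y" if "q > 0" for y q
        using b that by simp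
      ultimately show ?thesis
        using pos by metis
    qed
    show "((\<lambda>r. a * \<psi> (b * r)) has_real_derivative C + \<bar>a * \<psi> (b * r)\<bar> powr p) (at r)"
      if "\<bar>r\<bar> < R" for r
    proof -
      from DERIV_cmult[OF D\<psi>b[OF that], of a]
      have "((\<lambda>r. a * \<psi> (b * r)) has_real_derivative (a * b) * (1 + \<bar>\<psi> (b * r)\<bar> powr p)) (at r)"
        by (simp add: algebra_simps)
      moreover have "(a * b) * (1 + \<bar>\<psi> (b * r)\<bar> powr p) = C + \<bar>a * \<psi> (b * r)\<bar> powr p"
        using a by (simp add: ab abs_mult powr_mult ap algebra_simps)
      ultimately show ?thesis
        by simp
    qed
    show "a * \<psi> (b * 0) = 0"
      using \<psi>F[of 0] by (simp add: F0)
    have strict: "F s < F t" if "s < t" for s t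
      using F pos by (intro DERIV_pos_imp_increasing[OF that]) (meson zero_less_divide_1_iff)
    have "filterlim (\<lambda>r. \<psi> (b * r)) at_top (at_left R)"
      unfolding filterlim_at_top_dense
    proof
      fix Z
      have "max 0 (F Z / b) < R"
        using F_less[of Z] b R by (simp add: b_def field_simps)
      then have "eventually (\<lambda>r. r \<in> {max 0 (F Z / b)<..<R}) (at_left R)"
        by (rule eventually_at_left_real)
      then show "eventually (\<lambda>r. Z < \<psi> (b * r)) (at_left R)"
      proof (rule eventually_mono)
        fix r assume r: "r \<in> {max 0 (F Z / b)<..<R}"
        then have "F Z < F (\<psi> (b * r))"
          using b F\<psi>[OF in_I[of r]] by (simp add: field_simps)
        then show "Z < \<psi> (b * r)"
          using strict[of "\<psi> (b * r)" Z] by (cases "\<psi> (b * r)" Z rule: linorder_cases) auto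
      qed
    qed
    from filterlim_compose[OF energy_at_top[OF p H] this]
    show "filterlim (\<lambda>r. a / b * H (\<psi> (b * r))) at_top (at_left R)"
      using a b by (intro filterlim_tendsto_pos_mult_at_top[OF tendsto_const]) auto
  qed
qed

theorem proposition5p1:
  fixes R p C :: real
  assumes "R > 0" and "1 < p" and "p \<le> 2"
    and "C = (1 / R * integral {0..} (\<lambda>t::real. 1 / (1 + t powr p))) powr (p / (p - 1))"
  shows "\<exists>u :: real ^ 'n \<Rightarrow> real.
           C2_on (ball 0 R) u \<and> radial_on (ball 0 R) u \<and>
           (\<forall>x \<in> ball 0 R. - lambda_max (hessian u x) + norm (gradient u x) powr p = - C) \<and>
           blows_up_at_sphere R u"
proof -
  obtain g g' where g: "\<And>r. \<bar>r\<bar> < R \<Longrightarrow> (g has_real_derivative g' r) (at r)"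
    and g': "\<And>r. \<bar>r\<bar> < R \<Longrightarrow> (g' has_real_derivative C + \<bar>g' r\<bar> powr p) (at r)"
    and g'0: "g' 0 = 0" and top: "filterlim g at_top (at_left R)"
    using blow_up_profile[OF assms] by metis
  have C: "C \<ge> 0"
    using assms by simp
  interpret radial_profile R g g' "\<lambda>r. C + \<bar>g' r\<bar> powr p"
  proof
    show "isCont (\<lambda>r. C + \<bar>g' r\<bar> powr p) r" if "\<bar>r\<bar> < R" for r
      using isCont_o2[OF DERIV_isCont[OF g'[OF that]] isCont_abs_powr[of p]] assms(2)
      by (intro isCont_add[OF continuous_const]) simp
  qed (use assms g g' g'0 in auto)
  have g'_mono: "g' s \<le> g' r" if "0 \<le> s" "s \<le> r" "r < R" for s r
  proof (rule DERIV_nonneg_imp_nondecreasing[OF that(2)])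
    show "\<exists>y. (g' has_real_derivative y) (at t) \<and> 0 \<le> y" if "s \<le> t" "t \<le> r" for t
      using g'[of t] that \<open>0 \<le> s\<close> \<open>r < R\<close> C by (intro exI[of _ "C + \<bar>g' t\<bar> powr p"]) auto
  qed
  have mono: "C + \<bar>g' s\<bar> powr p \<le> C + \<bar>g' r\<bar> powr p" if "0 \<le> s" "s \<le> r" "r < R" for s r
    using g'_mono[OF that] g'_mono[of 0 s] that g'0 assms(2) by (intro add_left_mono powr_mono2) auto
  have "blows_up_at_sphere R (\<lambda>x :: real ^ 'n. g (norm x))"
    unfolding blows_up_at_sphere_def using top by (rule filterlim_filtercomapI)
  moreover have "radial_on (ball 0 R) (\<lambda>x :: real ^ 'n. g (norm x))"
    by (auto simp: radial_on_def)
  moreover have "\<forall>x \<in> ball 0 R. - lambda_max (hessian (\<lambda>x :: real ^ 'n. g (norm x)) x)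
      + norm (gradient (\<lambda>x :: real ^ 'n. g (norm x)) x) powr p = - C"
    by (simp add: lambda_max_hessian_radial[OF mono] norm_gradient_radial)
  ultimately show ?thesis
    by (intro exI[of _ "\<lambda>x :: real ^ 'n. g (norm x)"] conjI C2_on_radial)
qed

end
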